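(* For every integer $s\ge 2$, every locally $s$-colourable graph $G$ of chromatic number $\chi < \frac{11s+16}{6}$ satisfies $\varphi(G)\ge \chi-s$.
   Context: All graphs are finite, simple and non-empty. A graph $G$ is locally $s$-colourable if for every vertex $v$ the subgraph induced by the closed neighbourhood $N[v]$ has chromatic number at most $s$. For a proper colouring $\sigma$ of $G$, $\varphi_\sigma(G)=\max_{H}\big(|\sigma(V(H))|-\chi(H)\big)$ over all induced subgraphs $H$ of $G$; the chromatic discrepancy is $\varphi(G)=\min_\sigma \varphi_\sigma(G)$ over all proper colourings $\sigma$ of $G$. *)

theory Defs
  imports Complex_Main "Graph_Theory.Digraph_Component"
begin

text \<open>
  A finite simple graph is a symmetric, loop-free digraph without parallel arcs on a finite
  vertex set, i.e. an instance of the locale \<^locale>\<open>graph\<close>; adjacency of \<open>u\<close> and \<open>v\<close>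
  is \<open>u \<rightarrow>\<^bsub>G\<^esub> v\<close>. That locale admits the null graph, so non-emptiness is stated
  separately where it is needed. Colours are natural numbers; as graphs are finite,
  this is no restriction on the colourings considered.
\<close>

definition proper_colouring :: "('a,'b) pre_digraph \<Rightarrow> ('a \<Rightarrow> nat) \<Rightarrow> bool" where
  "proper_colouring G \<sigma> \<longleftrightarrow> (\<forall>u v. u \<rightarrow>\<^bsub>G\<^esub> v \<longrightarrow> \<sigma> u \<noteq> \<sigma> v)"

definition chromatic_number :: "('a,'b) pre_digraph \<Rightarrow> nat" where
  "chromatic_number G = (LEAST k. \<exists>\<sigma>. proper_colouring G \<sigma> \<and> card (\<sigma> ` verts G) = k)"

definition closed_neighbourhood :: "('a,'b) pre_digraph \<Rightarrow> 'a \<Rightarrow> 'a set" where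
  "closed_neighbourhood G v = insert v {u. v \<rightarrow>\<^bsub>G\<^esub> u}"

definition locally_colourable :: "nat \<Rightarrow> ('a,'b) pre_digraph \<Rightarrow> bool" where
  "locally_colourable s G \<longleftrightarrow>
     (\<forall>v \<in> verts G. chromatic_number (G \<restriction> closed_neighbourhood G v) \<le> s)"

definition colouring_discrepancy :: "('a,'b) pre_digraph \<Rightarrow> ('a \<Rightarrow> nat) \<Rightarrow> int" where
  "colouring_discrepancy G \<sigma> =
     Max {int (card (\<sigma> ` verts H)) - int (chromatic_number H) | H.
            induced_subgraph H G \<and> verts H \<noteq> {}}"

definition chromatic_discrepancy :: "('a,'b) pre_digraph \<Rightarrow> int" where
  "chromatic_discrepancy G = Min {colouring_discrepancy G \<sigma> | \<sigma>. proper_colouring G \<sigma>}"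

text \<open>
  For a non-empty graph the sets under \<^const>\<open>Max\<close> and \<^const>\<open>Min\<close> above are finite and
  non-empty, and the set under the \<open>LEAST\<close> is non-empty.
\<close>

lemma (in graph) ex_proper_colouring: "\<exists>\<sigma>. proper_colouring G \<sigma>"
proof -
  obtain f :: "'a \<Rightarrow> nat" where "inj_on f (verts G)"
    using finite_imp_inj_to_nat_seg[OF finite_verts] by blast
  then have "proper_colouring G f"
    unfolding proper_colouring_def
    by (metis adj_in_verts adj_not_same inj_on_def)
  then show ?thesis by blast
qed

lemma finite_induced_subgraphs:
  assumes "graph G"
  shows "finite {H. induced_subgraph H G}"
proof -
  interpret graph G by fact
  have "{H. induced_subgraph H G} \<subseteq> (\<lambda>S. G \<restriction> S) ` Pow (verts G)"
  proof
    fix H assume "H \<in> {H. induced_subgraph H G}"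
    then have H: "induced_subgraph H G" by simp
    then have "H = G \<restriction> verts H"
      by (cases H) (auto simp: induced_subgraph_def subgraph_def compatible_def induce_subgraph_def)
    moreover have "verts H \<subseteq> verts G"
      using H by (auto simp: induced_subgraph_def subgraph_def)
    ultimately show "H \<in> (\<lambda>S. G \<restriction> S) ` Pow (verts G)" by blast
  qed
  then show ?thesis by (rule finite_subset) simp
qed

lemma colouring_discrepancy_well_defined:
  assumes "graph G" "verts G \<noteq> {}"
  defines "D \<equiv> (\<lambda>\<sigma> :: 'a \<Rightarrow> nat. {int (card (\<sigma> ` verts H)) - int (chromatic_number H) | H :: ('a,'b) pre_digraph.
                 induced_subgraph H G \<and> verts H \<noteq> {}})"
  shows "finite (D \<sigma>)" "D \<sigma> \<noteq> {}"
proof -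
  interpret graph G by fact
  show "finite (D \<sigma>)"
    unfolding D_def using finite_induced_subgraphs[OF assms(1)] by simp
  show "D \<sigma> \<noteq> {}"
    unfolding D_def using induced_subgraph_refl assms(2) by blast
qed

lemma chromatic_number_le:
  "proper_colouring G \<sigma> \<Longrightarrow> chromatic_number G \<le> card (\<sigma> ` verts G)"
  unfolding chromatic_number_def by (rule Least_le) blast

lemma chromatic_discrepancy_well_defined:
  assumes "graph G" "verts G \<noteq> {}"
  shows "finite {colouring_discrepancy G \<sigma> | \<sigma>. proper_colouring G \<sigma>}"
    and "{colouring_discrepancy G \<sigma> | \<sigma>. proper_colouring G \<sigma>} \<noteq> {}"
proof -
  interpret graph G by fact
  show "{colouring_discrepancy G \<sigma> | \<sigma>. proper_colouring G \<sigma>} \<noteq> {}"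
    using ex_proper_colouring by blast
  have "colouring_discrepancy G \<sigma> \<in> {0..int (card (verts G))}"
    if \<sigma>: "proper_colouring G \<sigma>" for \<sigma>
  proof -
    note wd = colouring_discrepancy_well_defined[OF assms, of \<sigma>]
    have "colouring_discrepancy G \<sigma> \<in> {int (card (\<sigma> ` verts H)) - int (chromatic_number H) | H.
            induced_subgraph H G \<and> verts H \<noteq> {}}"
      unfolding colouring_discrepancy_def by (rule Max_in[OF wd])
    then obtain H where H: "induced_subgraph H G"
      "colouring_discrepancy G \<sigma> = int (card (\<sigma> ` verts H)) - int (chromatic_number H)" by blast
    have sub: "verts H \<subseteq> verts G" and ends: "arcs_ends H \<subseteq> arcs_ends G"
      using H(1) by (auto simp: induced_subgraph_def subgraph_def compatible_def arcs_ends_conv)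
    have "card (\<sigma> ` verts H) \<le> card (verts G)"
      by (meson card_image_le card_mono finite_subset finite_verts le_trans sub)
    moreover have "chromatic_number H \<le> card (\<sigma> ` verts H)"
      using \<sigma> ends by (intro chromatic_number_le) (auto simp: proper_colouring_def)
    ultimately show ?thesis using H(2) by simp
  qed
  then show "finite {colouring_discrepancy G \<sigma> | \<sigma>. proper_colouring G \<sigma>}"
    by (intro finite_subset[OF _ finite_atLeastAtMost_int[of 0 "int (card (verts G))"]]) blast
qed

end

theory Submission
  imports Defs
begin

text \<open>
  Let \<open>\<sigma>\<close> be a proper colouring with \<open>k\<close> colours and let \<open>\<chi>\<close> be the chromatic number of the graph.
  If \<open>k = \<chi>\<close>, some vertex sees all colours, and its closed neighbourhood is the required
  subgraph. If \<open>k > \<chi>\<close>, then any transversal \<open>R\<close> of the colour classes will do: otherwise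
  \<open>\<chi>(R) \<ge> s + k - \<chi> + 1 \<ge> s + 2\<close>, and a locally \<open>s\<close>-colourable graph \<open>R\<close> with
  \<open>\<chi>(R) \<ge> s + 2\<close> has at least \<open>11 \<chi>(R) / 6\<close> vertices, so \<open>6 \<chi> \<ge> 11 s + 16\<close>.

  For that last bound, a version of Gallai's theorem on critical graphs with few vertices shows
  that, up to deleting vertices without lowering the chromatic number, every graph is a join of
  blocks \<open>K\<close> with \<open>|K| \<ge> 2 \<chi>(K) - 1\<close>. If \<open>R\<close> had fewer than \<open>11 \<chi>(R) / 6\<close> vertices, some
  block would satisfy \<open>\<chi>(K) = c \<le> 5\<close> and \<open>|K| = 2 c - 1\<close>, while inheriting from \<open>R\<close> that it is
  locally \<open>(c - 2)\<close>-colourable; no such \<open>K\<close> exists.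
\<close>

section \<open>Hall's marriage theorem for finite families of finite sets\<close>

theorem hall:
  assumes "finite A" "\<And>a. a \<in> A \<Longrightarrow> finite (N a)"
    and "\<And>B. B \<subseteq> A \<Longrightarrow> card B \<le> card (\<Union>(N ` B))"
  shows "\<exists>g. inj_on g A \<and> (\<forall>a\<in>A. g a \<in> N a)"
  using assms
proof (induction "card A" arbitrary: A N rule: less_induct)
  case less
  note fin = less.prems(1) and finN = less.prems(2) and hall = less.prems(3)
  show ?case
  \<comment> \<open>If some proper non-empty \<open>B\<close> has no surplus of neighbours, then
    \<open>B\<close> and \<open>A - B\<close> are matched separately; otherwise every such set has a
    surplus, and one vertex can be matched at will.\<close>
  proof (cases "\<exists>B. B \<subset> A \<and> B \<noteq> {} \<and> card (\<Union>(N ` B)) \<le> card B")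
    case True
    then obtain B where B: "B \<subset> A" "B \<noteq> {}" "card (\<Union>(N ` B)) \<le> card B" by blast
    have finB: "finite B" using B(1) fin finite_subset by blast
    let ?U = "\<Union>(N ` B)"
    have finU: "finite ?U" using B(1) finB finN by blast
    have "\<exists>g. inj_on g B \<and> (\<forall>a\<in>B. g a \<in> N a)"
      using B(1) by (intro less.hyps psubset_card_mono fin finB finN hall) auto
    then obtain g where g: "inj_on g B" "\<forall>a\<in>B. g a \<in> N a" by blast
    have "\<exists>h. inj_on h (A - B) \<and> (\<forall>a\<in>A - B. h a \<in> N a - ?U)"
    proof (rule less.hyps)
      show "card (A - B) < card A"
        using B fin by (intro psubset_card_mono) auto
      show "card C \<le> card (\<Union>((\<lambda>a. N a - ?U) ` C))" if C: "C \<subseteq> A - B" for C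
      proof -
        have finC: "finite C" using C fin finite_subset by blast
        have finNC: "finite (\<Union>((\<lambda>a. N a - ?U) ` C))" using C finC finN by blast
        \<comment> \<open>Hall's condition for \<open>C \<union> B\<close> survives on
          \<open>C\<close>, because \<open>?U\<close> accounts for at most \<open>card B\<close> of
          the neighbours.\<close>
        have "card C + card B = card (C \<union> B)"
          using C finC finB by (intro card_Un_disjoint[symmetric]) auto
        also have "\<dots> \<le> card (\<Union>(N ` (C \<union> B)))"
          using C B(1) by (intro hall) auto
        also have "\<Union>(N ` (C \<union> B)) = \<Union>((\<lambda>a. N a - ?U) ` C) \<union> ?U" by auto
        also have "card \<dots> = card (\<Union>((\<lambda>a. N a - ?U) ` C)) + card ?U"
          using finNC finU by (intro card_Un_disjoint) auto
        finally show ?thesis using B(3) by linarith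
      qed
    qed (use fin finN in auto)
    then obtain h where h: "inj_on h (A - B)" "\<forall>a\<in>A - B. h a \<in> N a - ?U" by blast
    let ?f = "\<lambda>a. if a \<in> B then g a else h a"
    have "inj_on ?f A"
    proof (rule inj_onI)
      fix x y assume xy: "x \<in> A" "y \<in> A" "?f x = ?f y"
      have sep: "g u \<noteq> h v" if "u \<in> B" "v \<in> A - B" for u v
        using g(2) h(2) that by fastforce
      show "x = y"
        using xy sep g(1) h(1) by (auto simp: inj_on_def split: if_splits) metis+
    qed
    moreover have "\<forall>a\<in>A. ?f a \<in> N a" using g(2) h(2) by auto
    ultimately show ?thesis by blast
  next
    case False
    show ?thesis
    proof (cases "A = {}")
      case True
      then show ?thesis by auto
    next
      case False
      then obtain a where a: "a \<in> A" by blast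
      have "card {a} \<le> card (\<Union>(N ` {a}))" using a by (intro hall) auto
      then obtain x where x: "x \<in> N a" by fastforce
      have "\<exists>h. inj_on h (A - {a}) \<and> (\<forall>b\<in>A - {a}. h b \<in> N b - {x})"
      proof (rule less.hyps)
        show "card (A - {a}) < card A" using a fin by (meson card_Diff1_less)
        show "card C \<le> card (\<Union>((\<lambda>b. N b - {x}) ` C))" if C: "C \<subseteq> A - {a}" for C
        proof (cases "C = {}")
          case False
          \<comment> \<open>\<open>C\<close> misses \<open>a\<close>, so it is a proper subset with
            a surplus, which pays for the loss of \<open>x\<close>.\<close>
          have "\<not> card (\<Union>(N ` C)) \<le> card C"
            using \<open>\<nexists>B. B \<subset> A \<and> B \<noteq> {} \<and> card (\<Union>(N ` B)) \<le> card B\<close> False C a by blast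
          moreover have "\<Union>((\<lambda>b. N b - {x}) ` C) = \<Union>(N ` C) - {x}" by auto
          moreover have "card (\<Union>(N ` C)) - 1 \<le> card (\<Union>(N ` C) - {x})"
            by (simp add: card_Diff_singleton_if)
          ultimately show ?thesis by simp
        qed simp
      qed (use fin finN in auto)
      then obtain h where h: "inj_on h (A - {a})" "\<forall>b\<in>A - {a}. h b \<in> N b - {x}" by blast
      have "inj_on (h(a := x)) A"
        using h by (auto simp: inj_on_def)
      moreover have "\<forall>b\<in>A. (h(a := x)) b \<in> N b" using h(2) x by auto
      ultimately show ?thesis by blast
    qed
  qed
qed

section \<open>Chromatic numbers of vertex sets: monotonicity, unions and joins\<close>

locale adjacency =
  fixes E :: "'a \<Rightarrow> 'a \<Rightarrow> bool"
  assumes E_sym: "E u v \<Longrightarrow> E v u"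
    and E_irrefl: "\<not> E u u"
begin

definition proper_on :: "('a \<Rightarrow> 'c) \<Rightarrow> 'a set \<Rightarrow> bool" where
  "proper_on f A \<longleftrightarrow> (\<forall>u\<in>A. \<forall>v\<in>A. E u v \<longrightarrow> f u \<noteq> f v)"

text \<open>Induced subgraphs are represented by their vertex sets alone, so that deletions, unions
  and joins are plain set operations.\<close>

definition chi :: "'a set \<Rightarrow> nat" where
  "chi A = (LEAST k. \<exists>f :: 'a \<Rightarrow> nat. proper_on f A \<and> card (f ` A) = k)"

definition complete_to :: "'a set \<Rightarrow> 'a set \<Rightarrow> bool" where
  "complete_to A B \<longleftrightarrow> (\<forall>a\<in>A. \<forall>b\<in>B. E a b)"

definition closed_nbhd :: "'a set \<Rightarrow> 'a \<Rightarrow> 'a set" where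
  "closed_nbhd A x = insert x {u\<in>A. E x u}"

text \<open>The colours may come from any type: the finitely many that occur are injected into the
  naturals.\<close>

lemma chi_le:
  assumes "finite A" "proper_on f A"
  shows "chi A \<le> card (f ` A)"
proof -
  obtain i :: "'b \<Rightarrow> nat" where i: "inj_on i (f ` A)"
    using finite_imp_inj_to_nat_seg[of "f ` A"] assms(1) by blast
  have "proper_on (i \<circ> f) A"
    using assms(2) i by (auto simp: proper_on_def inj_on_def)
  then have "chi A \<le> card ((i \<circ> f) ` A)"
    unfolding chi_def by (intro Least_le) blast
  also have "\<dots> = card (f ` A)"
    by (simp only: image_comp[symmetric] card_image[OF i])
  finally show ?thesis .
qed

lemma chi_attained:
  assumes "finite A"
  obtains f :: "'a \<Rightarrow> nat" where "proper_on f A" "card (f ` A) = chi A"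
proof -
  obtain i :: "'a \<Rightarrow> nat" where i: "inj_on i A"
    using finite_imp_inj_to_nat_seg[OF assms] by blast
  have "proper_on i A"
    using i E_irrefl by (auto simp: proper_on_def inj_on_def)
  then have "\<exists>k. \<exists>f :: 'a \<Rightarrow> nat. proper_on f A \<and> card (f ` A) = k" by blast
  then have "\<exists>f :: 'a \<Rightarrow> nat. proper_on f A \<and> card (f ` A) = chi A"
    unfolding chi_def by (rule LeastI_ex)
  then show ?thesis using that by blast
qed

lemma chi_mono:
  assumes "finite B" "A \<subseteq> B"
  shows "chi A \<le> chi B"
proof -
  obtain f :: "'a \<Rightarrow> nat" where f: "proper_on f B" "card (f ` B) = chi B"
    using chi_attained[OF assms(1)] .
  have "chi A \<le> card (f ` A)"
    using f(1) assms by (intro chi_le) (auto simp: proper_on_def finite_subset)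
  also have "\<dots> \<le> card (f ` B)" using assms by (intro card_mono) auto
  finally show ?thesis using f(2) by simp
qed

lemma chi_le_card: "finite A \<Longrightarrow> chi A \<le> card A"
  using chi_le[of A "\<lambda>x. x"] E_irrefl by (auto simp: proper_on_def)

lemma chi_empty [simp]: "chi {} = 0"
  using chi_le_card[of "{}"] by simp

lemma chi_eq_0_iff: "finite A \<Longrightarrow> chi A = 0 \<longleftrightarrow> A = {}"
  by (rule chi_attained[of A]) auto

lemma chi_independent_le:
  assumes "finite A" "\<And>u v. u \<in> A \<Longrightarrow> v \<in> A \<Longrightarrow> \<not> E u v"
  shows "chi A \<le> 1"
proof -
  have "chi A \<le> card ((\<lambda>_. 0 :: nat) ` A)"
    using assms by (intro chi_le) (auto simp: proper_on_def)
  also have "\<dots> \<le> card {0 :: nat}" by (intro card_mono) auto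
  finally show ?thesis by simp
qed

lemma chi_ge_2:
  assumes "finite A" "u \<in> A" "v \<in> A" "E u v"
  shows "2 \<le> chi A"
proof -
  obtain f :: "'a \<Rightarrow> nat" where f: "proper_on f A" "card (f ` A) = chi A"
    using chi_attained[OF assms(1)] .
  have "card {f u, f v} \<le> card (f ` A)" using assms by (intro card_mono) auto
  moreover have "f u \<noteq> f v" using f(1) assms by (auto simp: proper_on_def)
  ultimately show ?thesis using f(2) by simp
qed

lemma chi_Un_le:
  assumes "finite A" "finite B"
  shows "chi (A \<union> B) \<le> chi A + chi B"
proof -
  obtain f :: "'a \<Rightarrow> nat" where f: "proper_on f A" "card (f ` A) = chi A"
    using chi_attained[OF assms(1)] .
  obtain g :: "'a \<Rightarrow> nat" where g: "proper_on g B" "card (g ` B) = chi B"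
    using chi_attained[OF assms(2)] .
  \<comment> \<open>The sum type keeps the two palettes apart; a vertex in both sets keeps its
    colour from \<open>A\<close>.\<close>
  let ?h = "\<lambda>u. if u \<in> A then Inl (f u) else (Inr (g u) :: nat + nat)"
  have "chi (A \<union> B) \<le> card (?h ` (A \<union> B))"
    using assms f(1) g(1) by (intro chi_le) (auto simp: proper_on_def)
  also have "\<dots> \<le> card (Inl ` f ` A \<union> Inr ` g ` B :: (nat + nat) set)"
    using assms by (intro card_mono) auto
  also have "\<dots> \<le> card (Inl ` f ` A :: (nat + nat) set) + card (Inr ` g ` B :: (nat + nat) set)"
    by (rule card_Un_le)
  also have "\<dots> = chi A + chi B" using f(2) g(2) by (simp add: card_image)
  finally show ?thesis .
qed

lemma chi_UN_le:
  assumes "finite I" "\<And>i. i \<in> I \<Longrightarrow> finite (h i)"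
  shows "chi (\<Union>i\<in>I. h i) \<le> (\<Sum>i\<in>I. chi (h i))"
  using assms
proof (induction I rule: finite_induct)
  case (insert i I)
  have "chi (\<Union>i\<in>insert i I. h i) \<le> chi (h i) + chi (\<Union>i\<in>I. h i)"
    using chi_Un_le[of "h i" "\<Union>i\<in>I. h i"] insert by simp
  also have "\<dots> \<le> chi (h i) + (\<Sum>i\<in>I. chi (h i))"
    using insert by auto
  finally show ?case using insert by simp
qed simp

lemma chi_le_remove:
  assumes "finite A"
  shows "chi A \<le> chi (A - {v}) + 1"
proof -
  have "chi A \<le> chi ((A - {v}) \<union> {v})" using assms by (intro chi_mono) auto
  also have "\<dots> \<le> chi (A - {v}) + chi {v}" using assms by (intro chi_Un_le) auto
  also have "chi {v} \<le> 1" using chi_le_card[of "{v}"] by simp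
  finally show ?thesis by simp
qed

lemma complete_to_sym: "complete_to A B \<Longrightarrow> complete_to B A"
  unfolding complete_to_def by (blast intro: E_sym)

lemma complete_to_mono: "complete_to A B \<Longrightarrow> A' \<subseteq> A \<Longrightarrow> B' \<subseteq> B \<Longrightarrow> complete_to A' B'"
  unfolding complete_to_def by blast

lemma complete_to_disjoint: "complete_to A B \<Longrightarrow> A \<inter> B = {}"
  using E_irrefl by (auto simp: complete_to_def)

text \<open>No colour can occur on both sides of a join, so the numbers of colours add up.\<close>

lemma chi_join:
  assumes "finite A" "finite B" "complete_to A B"
  shows "chi (A \<union> B) = chi A + chi B"
proof (rule antisym)
  obtain f :: "'a \<Rightarrow> nat" where f: "proper_on f (A \<union> B)" "card (f ` (A \<union> B)) = chi (A \<union> B)"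
    using chi_attained[of "A \<union> B"] assms by auto
  have "chi A + chi B \<le> card (f ` A) + card (f ` B)"
    using f(1) assms by (intro add_mono chi_le) (auto simp: proper_on_def)
  also have "\<dots> = card (f ` A \<union> f ` B)"
    using f(1) assms by (intro card_Un_disjoint[symmetric]) (auto simp: proper_on_def complete_to_def)
  finally show "chi A + chi B \<le> chi (A \<union> B)" using f(2) by (simp add: image_Un)
qed (use assms chi_Un_le in blast)

lemma chi_Union_complete:
  assumes "finite K" "\<And>A. A \<in> K \<Longrightarrow> finite A" "pairwise complete_to K"
  shows "chi (\<Union>K) = (\<Sum>A\<in>K. chi A)"
  using assms
proof (induction K rule: finite_induct)
  case (insert A K)
  have "complete_to A (\<Union>K)"
    using insert.prems(2) insert.hyps by (auto simp: pairwise_def complete_to_def)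
  then have "chi (\<Union>(insert A K)) = chi A + chi (\<Union>K)"
    using chi_join[of A "\<Union>K"] insert by simp
  then show ?case using insert by (simp add: pairwise_insert)
qed simp

lemma card_Union_complete:
  assumes "\<And>A. A \<in> K \<Longrightarrow> finite A" "pairwise complete_to K"
  shows "card (\<Union>K) = (\<Sum>A\<in>K. card A)"
  using assms complete_to_disjoint
  by (intro card_Union_disjoint) (auto simp: pairwise_def disjnt_def)

section \<open>Gallai's decomposition into blocks\<close>

definition tight :: "'a set \<Rightarrow> bool" where
  "tight K \<longleftrightarrow> card K + 1 = 2 * chi K"

text \<open>The union of the family is the join of its members. Only tight blocks have to be
  vertex-critical, since only they exchange a vertex with an outside one. The empty set is a
  non-tight block.\<close>

definition block_family :: "'a set set \<Rightarrow> bool" where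
  "block_family \<K> \<longleftrightarrow> pairwise complete_to \<K> \<and>
     (\<forall>K\<in>\<K>. 2 * chi K \<le> card K \<or> (tight K \<and> (\<forall>v\<in>K. chi (K - {v}) < chi K)))"

text \<open>A tight block falls short of two vertices per colour by exactly one, any other block not
  at all.\<close>

lemma block_family_count:
  assumes "block_family \<K>" "finite \<K>" "M \<subseteq> \<K>"
  shows "2 * (\<Sum>K\<in>M. chi K) \<le> (\<Sum>K\<in>M. card K) + card {K\<in>M. tight K}"
proof -
  have fin: "finite M" using assms finite_subset by blast
  have "2 * (\<Sum>K\<in>M. chi K) = (\<Sum>K\<in>M. 2 * chi K)" by (simp add: sum_distrib_left)
  also have "\<dots> \<le> (\<Sum>K\<in>M. card K + (if tight K then 1 else 0))"
    using assms by (intro sum_mono) (auto simp: block_family_def tight_def)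
  also have "\<dots> = (\<Sum>K\<in>M. card K) + card {K\<in>M. tight K}"
    using fin by (simp add: sum.distrib sum.If_cases Int_def)
  finally show ?thesis .
qed

text \<open>
  Hall's theorem is applied to the vertices \<open>B\<close> outside the blocks and the tight blocks they are not
  complete to. A matching would absorb \<open>B\<close> without extra colours, each \<open>b\<close> sharing the class of a
  critical vertex of its block; a violating set \<open>B'\<close> is merged with the tight blocks it meets, and
  with all non-tight blocks, into one non-tight block.
\<close>

lemma enlarge_block_family:
  assumes fin: "finite V"
    and critical: "\<And>v. v \<in> V \<Longrightarrow> chi (V - {v}) < chi V"
    and no_join: "\<And>A. A \<subset> V \<Longrightarrow> A \<noteq> {} \<Longrightarrow> \<not> complete_to A (V - A)"
    and small: "card V + 2 \<le> 2 * chi V"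
    and \<K>: "block_family \<K>" "\<Union>\<K> \<subseteq> V" "chi (\<Union>\<K>) + 1 = chi V"
  obtains \<K>' where "block_family \<K>'" "\<Union>\<K>' \<subseteq> V" "chi (\<Union>\<K>') + 1 = chi V"
    "card (\<Union>\<K>) < card (\<Union>\<K>')"
proof -
  have fin\<K>: "finite \<K>" using fin \<K>(2) by (meson finite_UnionD finite_subset)
  have finK: "finite K" if "K \<in> \<K>" for K using that fin \<K>(2) by (meson Union_upper finite_subset)
  have pw: "pairwise complete_to \<K>" using \<K>(1) by (simp add: block_family_def)
  define B where "B = V - \<Union>\<K>"
  define T where "T = {K\<in>\<K>. tight K}"
  define N where "N b = {K\<in>T. \<exists>t\<in>K. \<not> E b t}" for b
  have finB: "finite B" and finT: "finite T"
    using fin fin\<K> by (auto simp: B_def T_def)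
  have chi_sum: "chi (\<Union>M) = (\<Sum>K\<in>M. chi K)" if "M \<subseteq> \<K>" for M
    using that fin\<K> finK pw
    by (intro chi_Union_complete) (auto intro: finite_subset pairwise_subset)
  have card_sum: "card (\<Union>M) = (\<Sum>K\<in>M. card K)" if "M \<subseteq> \<K>" for M
    using that finK pw by (intro card_Union_complete) (auto intro: pairwise_subset)
  have "card V = card B + card (\<Union>\<K>)"
    using fin \<K>(2) unfolding B_def
    by (simp add: card_Diff_subset card_mono finite_subset)
  moreover have "2 * chi (\<Union>\<K>) \<le> card (\<Union>\<K>) + card T"
    using block_family_count[OF \<K>(1) fin\<K> order.refl] chi_sum card_sum by (simp add: T_def)
  \<comment> \<open>By \<open>small\<close>, \<open>card B + card (\<Union>\<K>) \<le> 2 * chi V - 2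
    = 2 * chi (\<Union>\<K>) \<le> card (\<Union>\<K>) + card T\<close>.\<close>
  ultimately have card_B: "card B \<le> card T" using small \<K>(3) by linarith
  have "\<not> (\<forall>B'\<subseteq>B. card B' \<le> card (\<Union>(N ` B')))"
  proof
    assume "\<forall>B'\<subseteq>B. card B' \<le> card (\<Union>(N ` B'))"
    then obtain g where g: "inj_on g B" "\<And>b. b \<in> B \<Longrightarrow> g b \<in> N b"
      using hall[of B N] finB finT by (auto simp: N_def)
    define h where "h K = (if K \<in> g ` B then insert (inv_into B g K) K else K)" for K
    have h_le: "chi (h K) \<le> chi K" if K: "K \<in> \<K>" for K
    proof (cases "K \<in> g ` B")
      case True
      then obtain b where b: "b \<in> B" "K = g b" by blast
      obtain t where t: "t \<in> K" "\<not> E b t" using g(2)[OF b(1)] b(2) by (auto simp: N_def)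
      have "b \<notin> K" using b(1) K by (auto simp: B_def)
      have "K \<in> T" using g(2)[OF b(1)] b(2) by (simp add: N_def)
      then have crit: "chi (K - {t}) < chi K"
        using \<K>(1) K t(1) by (auto simp: block_family_def T_def tight_def)
      \<comment> \<open>\<open>K - {t}\<close> needs fewer colours than \<open>K\<close>, and the
        non-adjacent pair \<open>b\<close>, \<open>t\<close> shares the one saved.\<close>
      have "h K \<subseteq> (K - {t}) \<union> {b, t}" using True b inv_into_f_f[OF g(1)] by (auto simp: h_def)
      then have "chi (h K) \<le> chi ((K - {t}) \<union> {b, t})" using finK[OF K] by (intro chi_mono) auto
      also have "\<dots> \<le> chi (K - {t}) + chi {b, t}" using finK[OF K] by (intro chi_Un_le) auto
      also have "chi {b, t} \<le> 1"
        using t(2) E_irrefl E_sym[of t b] by (intro chi_independent_le) auto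
      finally show ?thesis using crit by simp
    qed (simp add: h_def)
    have finh: "finite (h K)" if "K \<in> \<K>" for K using finK[OF that] by (simp add: h_def)
    have "V \<subseteq> (\<Union>K\<in>\<K>. h K)"
    proof
      fix v assume v: "v \<in> V"
      show "v \<in> (\<Union>K\<in>\<K>. h K)"
      proof (cases "v \<in> B")
        case True
        then have "v \<in> h (g v)" using inv_into_f_f[OF g(1)] by (auto simp: h_def)
        moreover have "g v \<in> \<K>" using g(2)[OF True] by (auto simp: N_def T_def)
        ultimately show ?thesis by blast
      next
        case False
        then show ?thesis using v by (auto simp: B_def h_def)
      qed
    qed
    then have "chi V \<le> chi (\<Union>K\<in>\<K>. h K)" using fin\<K> finh by (intro chi_mono) auto
    also have "\<dots> \<le> (\<Sum>K\<in>\<K>. chi (h K))" using fin\<K> finh by (rule chi_UN_le)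
    also have "\<dots> \<le> (\<Sum>K\<in>\<K>. chi K)" using h_le by (rule sum_mono)
    also have "\<dots> = chi (\<Union>\<K>)" by (simp add: chi_sum)
    finally show False using \<K>(3) by simp
  qed
  then obtain B' where B': "B' \<subseteq> B" "card (\<Union>(N ` B')) < card B'" by auto
  define T' where "T' = \<Union>(N ` B')"
  have card_T': "card T' < card B'" unfolding T'_def by (rule B'(2))
  \<comment> \<open>The blocks in \<open>T - T'\<close> are kept; each is complete to
    \<open>B'\<close> by the choice of \<open>T'\<close>. All other blocks are merged with
    \<open>B'\<close> into \<open>\<Omega>\<close>.\<close>
  define M where "M = \<K> - (T - T')"
  define \<Omega> where "\<Omega> = B' \<union> \<Union>M"
  have T': "T' \<subseteq> T" by (auto simp: T'_def N_def)
  have T\<K>: "T \<subseteq> \<K>" and M\<K>: "M \<subseteq> \<K>" by (auto simp: T_def M_def)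
  have finB': "finite B'" using B'(1) finB finite_subset by blast
  have B'_nonempty: "B' \<noteq> {}" using B'(2) by auto
  have B'_disj: "B' \<inter> \<Union>\<K> = {}" using B'(1) by (auto simp: B_def)
  have \<Omega>_complete: "complete_to K \<Omega>" if K: "K \<in> T - T'" for K
  proof -
    have "E x b" if "b \<in> B'" "x \<in> K" for x b
    proof -
      have "E b x" using that K by (auto simp: T'_def N_def)
      then show ?thesis by (rule E_sym)
    qed
    moreover have "complete_to K L" if "L \<in> M" for L
    proof (rule pairwiseD[OF pw])
      show "K \<noteq> L" using that K by (auto simp: M_def)
    qed (use that K T\<K> M\<K> in auto)
    ultimately show ?thesis unfolding \<Omega>_def complete_to_def by blast
  qed
  define \<K>' where "\<K>' = insert \<Omega> (T - T')"
  have U\<K>': "\<Union>\<K>' = B' \<union> \<Union>\<K>" using T\<K> by (auto simp: \<K>'_def \<Omega>_def M_def)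
  have sub: "\<Union>\<K>' \<subseteq> V" using U\<K>' B'(1) \<K>(2) by (auto simp: B_def)
  have bigger: "card (\<Union>\<K>) < card (\<Union>\<K>')"
  proof (rule psubset_card_mono)
    show "finite (\<Union>\<K>')" by (rule finite_subset[OF sub fin])
    show "\<Union>\<K> \<subset> \<Union>\<K>'" unfolding U\<K>' using B'_nonempty B'_disj by blast
  qed
  have pw': "pairwise complete_to (T - T')" by (rule pairwise_subset[OF pw]) (use T\<K> in blast)
  have pairwise': "pairwise complete_to \<K>'"
    unfolding \<K>'_def pairwise_insert using pw' \<Omega>_complete complete_to_sym by blast
  \<comment> \<open>If \<open>B' = B\<close>, then \<open>card T' < card B \<le> card T\<close>
    leaves a block in \<open>T - T'\<close>, and it is complete to the rest of \<open>V\<close>,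
    against \<open>no_join\<close>.\<close>
  have "B - B' \<noteq> {}"
  proof
    assume "B - B' = {}"
    then have BB': "B' = B" using B'(1) by blast
    have "\<not> T \<subseteq> T'"
    proof
      assume "T \<subseteq> T'"
      then have "card T \<le> card T'" by (rule card_mono[OF finite_subset[OF T' finT]])
      then show False using card_B card_T' unfolding BB' by linarith
    qed
    then obtain K where K: "K \<in> T - T'" by blast
    have "K \<noteq> {}" using K by (auto simp: T_def tight_def)
    moreover have "K \<subset> V"
    proof -
      have "K \<subseteq> \<Union>\<K>" using K T\<K> by blast
      then show ?thesis using \<K>(2) B'_nonempty B'_disj B'(1) unfolding B_def by blast
    qed
    moreover have "complete_to K (V - K)"
    proof -
      have "V - K \<subseteq> \<Omega> \<union> \<Union>(T - T' - {K})"
        using BB' by (auto simp: \<Omega>_def M_def B_def)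
      moreover have "complete_to K (\<Union>(T - T' - {K}))"
        using pw' K unfolding pairwise_def complete_to_def by blast
      ultimately show ?thesis
        using \<Omega>_complete[OF K] unfolding complete_to_def by blast
    qed
    ultimately show False using no_join by blast
  qed
  then obtain a where a: "a \<in> B" "a \<notin> B'" by blast
  \<comment> \<open>The new union still avoids \<open>a\<close>, so criticality of \<open>V\<close>
    keeps its chromatic number below \<open>chi V\<close>: the added vertices cost no
    colour.\<close>
  have "\<Union>\<K>' \<subseteq> V - {a}" using sub U\<K>' a by (auto simp: B_def)
  then have "chi (\<Union>\<K>') \<le> chi (V - {a})" using fin by (intro chi_mono) auto
  also have "\<dots> < chi V" using a by (intro critical) (simp add: B_def)
  finally have "chi (\<Union>\<K>') < chi V" .
  moreover have "chi (\<Union>\<K>) \<le> chi (\<Union>\<K>')"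
    using U\<K>' sub fin by (intro chi_mono) (auto intro: finite_subset)
  ultimately have chi_eq: "chi (\<Union>\<K>') = chi (\<Union>\<K>)" using \<K>(3) by linarith
  have fin\<Omega>: "finite \<Omega>" using sub fin by (auto simp: \<K>'_def intro: finite_subset)
  have "chi (\<Union>\<K>') = chi (\<Omega> \<union> \<Union>(T - T'))" by (simp add: \<K>'_def)
  also have "\<dots> = chi \<Omega> + chi (\<Union>(T - T'))"
  proof (rule chi_join)
    show "complete_to \<Omega> (\<Union>(T - T'))"
      unfolding complete_to_def
    proof (intro ballI)
      fix a b assume "a \<in> \<Omega>" "b \<in> \<Union>(T - T')"
      then show "E a b" using \<Omega>_complete unfolding complete_to_def by (blast intro: E_sym)
    qed
    show "finite (\<Union>(T - T'))" by (rule finite_subset[OF _ fin]) (use T\<K> \<K>(2) in blast)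
  qed (rule fin\<Omega>)
  finally have "chi \<Omega> + chi (\<Union>(T - T')) = chi (\<Union>\<K>)" using chi_eq by simp
  moreover have "chi (\<Union>\<K>) = chi (\<Union>M) + chi (\<Union>(T - T'))"
  proof -
    have "(\<Sum>K\<in>\<K>. chi K) = (\<Sum>K\<in>M. chi K) + (\<Sum>K\<in>T - T'. chi K)"
      unfolding M_def using fin\<K> T\<K> by (intro sum.subset_diff) auto
    moreover have "T - T' \<subseteq> \<K>" using T\<K> by blast
    ultimately show ?thesis using chi_sum[OF order.refl] chi_sum[OF M\<K>] chi_sum[of "T - T'"] by simp
  qed
  ultimately have chi_\<Omega>: "chi \<Omega> = chi (\<Union>M)" by simp
  \<comment> \<open>The blocks of \<open>M\<close> lack at most \<open>card T'\<close> vertices in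
    total, and the larger set \<open>B'\<close> makes up for them, so \<open>\<Omega>\<close> is not
    tight.\<close>
  have "{K\<in>M. tight K} = T'" using T' T\<K> by (auto simp: M_def T_def)
  then have "2 * chi (\<Union>M) \<le> card (\<Union>M) + card T'"
    using block_family_count[OF \<K>(1) fin\<K> M\<K>] chi_sum[OF M\<K>] card_sum[OF M\<K>] by simp
  moreover have "card \<Omega> = card B' + card (\<Union>M)"
    unfolding \<Omega>_def
  proof (rule card_Un_disjoint[OF finB'])
    show "finite (\<Union>M)" using fin\<Omega> unfolding \<Omega>_def by simp
    show "B' \<inter> \<Union>M = {}" using B'_disj M\<K> by blast
  qed
  ultimately have "2 * chi \<Omega> \<le> card \<Omega>" using chi_\<Omega> card_T' by linarith
  then have "block_family \<K>'"
    using pairwise' \<K>(1) T\<K> unfolding block_family_def \<K>'_def by blast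
  then show ?thesis
  proof (rule that)
    show "chi (\<Union>\<K>') + 1 = chi V" using chi_eq \<K>(3) by simp
  qed (rule sub bigger)+
qed

text \<open>Strong induction on the order. A non-critical vertex is deleted, and the families of the
  two sides of a join are united. Otherwise \<open>V\<close> is itself a block unless
  \<open>card V + 2 \<le> 2 * chi V\<close>, which \<open>enlarge_block_family\<close>
  refutes.\<close>

theorem gallai_block_family:
  assumes "finite V"
  shows "\<exists>\<K>. block_family \<K> \<and> \<Union>\<K> \<subseteq> V \<and> chi (\<Union>\<K>) = chi V"
  using assms
proof (induction "card V" arbitrary: V rule: less_induct)
  case less
  note fin = less.prems
  have IH: "\<exists>\<K>. block_family \<K> \<and> \<Union>\<K> \<subseteq> W \<and> chi (\<Union>\<K>) = chi W" if "W \<subset> V" for W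
    using that fin by (intro less.hyps psubset_card_mono) (auto intro: finite_subset)
  show ?case
  proof (cases "\<exists>v\<in>V. chi (V - {v}) = chi V")
    case True
    then obtain v where v: "v \<in> V" "chi (V - {v}) = chi V" by blast
    then show ?thesis using IH[of "V - {v}"] by fastforce
  next
    case False
    have critical: "chi (V - {v}) < chi V" if "v \<in> V" for v
      using False that chi_mono[of V "V - {v}"] fin by (metis Diff_subset le_neq_implies_less)
    show ?thesis
    proof (cases "\<exists>A. A \<subset> V \<and> A \<noteq> {} \<and> complete_to A (V - A)")
      case True
      then obtain A where A: "A \<subset> V" "A \<noteq> {}" "complete_to A (V - A)" by blast
      obtain \<K> where \<K>: "block_family \<K>" "\<Union>\<K> \<subseteq> A" "chi (\<Union>\<K>) = chi A"
        using IH[OF A(1)] by blast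
      have VA: "V - A \<subset> V" using A by blast
      obtain \<L> where \<L>: "block_family \<L>" "\<Union>\<L> \<subseteq> V - A" "chi (\<Union>\<L>) = chi (V - A)"
        using IH[OF VA] by blast
      have finA: "finite A" using A(1) fin finite_subset by blast
      have cross: "complete_to K L" if "K \<in> \<K>" "L \<in> \<L>" for K L
        by (rule complete_to_mono[OF A(3)]) (use that \<K>(2) \<L>(2) in blast)+
      have "block_family (\<K> \<union> \<L>)"
        unfolding block_family_def
      proof (intro conjI pairwiseI)
        fix K L assume "K \<in> \<K> \<union> \<L>" "L \<in> \<K> \<union> \<L>" "K \<noteq> L"
        then show "complete_to K L"
          using \<K>(1) \<L>(1) cross complete_to_sym[OF cross]
          unfolding block_family_def by (metis UnE pairwiseD)
      qed (use \<K>(1) \<L>(1) in \<open>auto simp: block_family_def\<close>)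
      moreover have "chi (\<Union>(\<K> \<union> \<L>)) = chi V"
      proof -
        have "complete_to (\<Union>\<K>) (\<Union>\<L>)" using A(3) \<K>(2) \<L>(2) by (rule complete_to_mono)
        moreover have "finite (\<Union>\<K>)" "finite (\<Union>\<L>)"
          using \<K>(2) \<L>(2) finA fin by (meson finite_Diff finite_subset)+
        ultimately have "chi (\<Union>\<K> \<union> \<Union>\<L>) = chi A + chi (V - A)"
          using \<K>(3) \<L>(3) by (simp add: chi_join)
        also have "\<dots> = chi (A \<union> (V - A))"
          using A(3) finA fin by (intro chi_join[symmetric]) auto
        also have "A \<union> (V - A) = V" using A(1) by blast
        finally show ?thesis by simp
      qed
      moreover have "\<Union>(\<K> \<union> \<L>) \<subseteq> V" using \<K>(2) \<L>(2) A(1) by auto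
      ultimately show ?thesis by blast
    next
      case no_join: False
      show ?thesis
      proof (cases "V \<noteq> {} \<and> card V + 2 \<le> 2 * chi V")
        case True
        \<comment> \<open>Families that miss exactly one colour exist, by induction on
          \<open>V - {v}\<close>. One with the largest union would admit no enlargement.\<close>
        define P where "P \<K> \<longleftrightarrow> block_family \<K> \<and> \<Union>\<K> \<subseteq> V \<and> chi (\<Union>\<K>) + 1 = chi V" for \<K>
        obtain v where v: "v \<in> V" using True by blast
        then have Vv: "V - {v} \<subset> V" by blast
        obtain \<K>\<^sub>0 where "block_family \<K>\<^sub>0" "\<Union>\<K>\<^sub>0 \<subseteq> V - {v}" "chi (\<Union>\<K>\<^sub>0) = chi (V - {v})"
          using IH[OF Vv] by blast
        moreover have "chi (V - {v}) + 1 = chi V"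
          using critical[OF v] chi_le_remove[OF fin, of v] by linarith
        ultimately have "P \<K>\<^sub>0" by (auto simp: P_def)
        moreover have "\<forall>\<K>. P \<K> \<longrightarrow> card (\<Union>\<K>) < card V + 1"
          using fin by (auto simp: P_def less_Suc_eq_le intro: card_mono)
        ultimately have "\<exists>\<K>. P \<K> \<and> (\<forall>\<K>'. P \<K>' \<longrightarrow> card (\<Union>\<K>') \<le> card (\<Union>\<K>))"
          by (rule ex_has_greatest_nat)
        then obtain \<K> where \<K>: "P \<K>" "\<And>\<K>'. P \<K>' \<Longrightarrow> card (\<Union>\<K>') \<le> card (\<Union>\<K>)"
          by blast
        have nj: "\<not> complete_to A (V - A)" if "A \<subset> V" "A \<noteq> {}" for A
          using no_join that by blast
        have \<K>': "block_family \<K>" "\<Union>\<K> \<subseteq> V" "chi (\<Union>\<K>) + 1 = chi V"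
          using \<K>(1) by (simp_all add: P_def)
        obtain \<K>' where "block_family \<K>'" "\<Union>\<K>' \<subseteq> V" "chi (\<Union>\<K>') + 1 = chi V"
            "card (\<Union>\<K>) < card (\<Union>\<K>')"
          using enlarge_block_family[OF fin critical nj _ \<K>'] True by blast
        then have "P \<K>'" "card (\<Union>\<K>) < card (\<Union>\<K>')" by (simp_all add: P_def)
        then show ?thesis using \<K>(2) by fastforce
      next
        case False
        have "2 * chi V \<le> card V \<or> tight V"
          using False by (cases "V = {}") (auto simp: tight_def)
        then have "block_family {V}"
          using critical by (auto simp: block_family_def)
        then show ?thesis by (intro exI[of _ "{V}"]) auto
      qed
    qed
  qed
qed

text \<open>Order and chromatic number are additive over the blocks, so some block \<open>K\<close>
  is as dense as required. The other blocks lie in the neighbourhood of each \<open>x\<close> in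
  \<open>K\<close> and add the same amount to both chromatic numbers, so \<open>K\<close> inherits
  the local gap of \<open>V\<close>; the inequality is kept additive to avoid truncated
  subtraction.\<close>

lemma dense_block:
  assumes fin: "finite V" and dense: "a * card V < b * chi V"
  obtains K where "K \<subseteq> V" "a * card K < b * chi K" "2 * chi K \<le> card K + 1"
    "\<And>x. x \<in> K \<Longrightarrow> chi (closed_nbhd K x) + chi V \<le> chi (closed_nbhd V x) + chi K"
proof -
  obtain \<K> where \<K>: "block_family \<K>" "\<Union>\<K> \<subseteq> V" "chi (\<Union>\<K>) = chi V"
    using gallai_block_family[OF fin] by blast
  have finU: "finite (\<Union>\<K>)" by (rule finite_subset[OF \<K>(2) fin])
  have fin\<K>: "finite \<K>" by (rule finite_UnionD[OF finU])
  have finK: "finite K" if "K \<in> \<K>" for K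
    by (rule finite_subset[OF _ finU]) (use that in blast)
  have pw: "pairwise complete_to \<K>" using \<K>(1) by (simp add: block_family_def)
  have "\<exists>K\<in>\<K>. a * card K < b * chi K"
  proof (rule ccontr)
    assume "\<not> ?thesis"
    then have "(\<Sum>K\<in>\<K>. b * chi K) \<le> (\<Sum>K\<in>\<K>. a * card K)"
      by (intro sum_mono) (auto simp: not_less)
    then have "b * chi (\<Union>\<K>) \<le> a * card (\<Union>\<K>)"
      using chi_Union_complete[OF fin\<K> finK pw] card_Union_complete[OF finK pw]
      by (simp add: sum_distrib_left)
    also have "\<dots> \<le> a * card V" using card_mono[OF fin \<K>(2)] by simp
    finally show False using dense \<K>(3) by simp
  qed
  then obtain K where K: "K \<in> \<K>" "a * card K < b * chi K" by blast
  let ?R = "\<Union>(\<K> - {K})"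
  have finR: "finite ?R" by (rule finite_subset[OF _ finU]) blast
  have comp: "complete_to K ?R"
    using pw K(1) unfolding pairwise_def complete_to_def by blast
  have chi_V: "chi V = chi K + chi ?R"
  proof -
    have "\<Union>\<K> = K \<union> ?R" using K(1) by blast
    then show ?thesis using chi_join[OF finK[OF K(1)] finR comp] \<K>(3) by simp
  qed
  have nbhd: "chi (closed_nbhd K x) + chi V \<le> chi (closed_nbhd V x) + chi K" if x: "x \<in> K" for x
  proof -
    have sub: "closed_nbhd K x \<subseteq> K" using x by (auto simp: closed_nbhd_def)
    have "closed_nbhd K x \<union> ?R \<subseteq> closed_nbhd V x"
      using comp x K(1) \<K>(2) by (auto simp: closed_nbhd_def complete_to_def)
    moreover have "finite (closed_nbhd V x)" using fin by (simp add: closed_nbhd_def)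
    ultimately have "chi (closed_nbhd K x \<union> ?R) \<le> chi (closed_nbhd V x)" by (intro chi_mono)
    moreover have "chi (closed_nbhd K x \<union> ?R) = chi (closed_nbhd K x) + chi ?R"
      by (rule chi_join[OF finite_subset[OF sub finK[OF K(1)]] finR complete_to_mono[OF comp sub order.refl]])
    ultimately show ?thesis using chi_V by simp
  qed
  have "2 * chi K \<le> card K + 1"
    using \<K>(1) K(1) by (auto simp: block_family_def tight_def)
  moreover have "K \<subseteq> V" using K(1) \<K>(2) by blast
  ultimately show ?thesis using that K(2) nbhd by blast
qed

section \<open>Lower bounds on the order of locally colourable graphs\<close>

lemma finite_closed_nbhd: "finite A \<Longrightarrow> finite (closed_nbhd A x)"
  by (simp add: closed_nbhd_def)

lemma chi_closed_nbhd_pos: "finite A \<Longrightarrow> 1 \<le> chi (closed_nbhd A x)"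
  using chi_eq_0_iff[OF finite_closed_nbhd] by (metis One_nat_def Suc_leI closed_nbhd_def insert_not_empty neq0_conv)

text \<open>In a counterexample, \<open>3 * (2 * chi K - 1) < 5 * chi K\<close> gives a dense block
  with \<open>chi K \<le> 2\<close>. An edge would make a closed neighbourhood 2-chromatic, so
  \<open>K\<close> is edgeless, and then even a single vertex violates the local gap. The 5-cycle
  attains equality.\<close>

lemma card_ge_5_3_chi:
  assumes fin: "finite V" and local: "\<And>x. x \<in> V \<Longrightarrow> chi (closed_nbhd V x) < chi V"
  shows "5 * chi V \<le> 3 * card V"
proof (rule ccontr)
  assume "\<not> ?thesis"
  then have "3 * card V < 5 * chi V" by simp
  then obtain K where K: "K \<subseteq> V" "3 * card K < 5 * chi K" "2 * chi K \<le> card K + 1"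
    "\<And>x. x \<in> K \<Longrightarrow> chi (closed_nbhd K x) + chi V \<le> chi (closed_nbhd V x) + chi K"
    using dense_block[OF fin] by metis
  have finK: "finite K" by (rule finite_subset[OF K(1) fin])
  have small: "chi K \<le> 2" using K(2,3) by linarith
  have nbhd: "chi (closed_nbhd K x) < chi K" if "x \<in> K" for x
    using K(4)[OF that] local[of x] that K(1) by fastforce
  have "\<not> E u v" if "u \<in> K" "v \<in> K" for u v
  proof
    assume "E u v"
    then have "2 \<le> chi (closed_nbhd K u)"
      using that finK by (intro chi_ge_2[of _ u v] finite_closed_nbhd) (auto simp: closed_nbhd_def)
    then show False using nbhd[OF that(1)] small by linarith
  qed
  then have "chi K \<le> 1" by (rule chi_independent_le[OF finK])
  moreover obtain x where "x \<in> K" using K(2) by fastforce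
  ultimately show False
    using nbhd[of x] chi_closed_nbhd_pos[OF finK, of x] by simp
qed

text \<open>Colour classes are independent, hence of size at most two here.\<close>

lemma card_le_2_chi:
  assumes fin: "finite A"
    and no_triple: "\<And>I. I \<subseteq> A \<Longrightarrow> card I = 3 \<Longrightarrow> \<exists>u\<in>I. \<exists>v\<in>I. E u v"
  shows "card A \<le> 2 * chi A"
proof -
  obtain f :: "'a \<Rightarrow> nat" where f: "proper_on f A" "card (f ` A) = chi A"
    using chi_attained[OF fin] .
  have "card {u\<in>A. f u = c} \<le> 2" for c
  proof (rule ccontr)
    assume "\<not> ?thesis"
    then have "3 \<le> card {u\<in>A. f u = c}" by simp
    then obtain I where "I \<subseteq> {u\<in>A. f u = c}" "card I = 3"
      by (meson obtain_subset_with_card_n)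
    then show False using no_triple[of I] f(1) by (auto simp: proper_on_def subset_iff)
  qed
  then have "(\<Sum>c\<in>f ` A. card {u\<in>A. f u = c}) \<le> (\<Sum>c\<in>f ` A. 2)" by (intro sum_mono)
  moreover have "card A = (\<Sum>c\<in>f ` A. card {u\<in>A. f u = c})"
    using sum.image_gen[OF fin, of "\<lambda>_. 1 :: nat" f] by simp
  ultimately show ?thesis using f(2) by simp
qed

lemma card_clique_le:
  assumes "finite A" "\<And>u v. u \<in> A \<Longrightarrow> v \<in> A \<Longrightarrow> u \<noteq> v \<Longrightarrow> E u v"
  shows "card A \<le> chi A"
proof -
  obtain f :: "'a \<Rightarrow> nat" where f: "proper_on f A" "card (f ` A) = chi A"
    using chi_attained[OF assms(1)] .
  have "inj_on f A" using f(1) assms(2) unfolding inj_on_def proper_on_def by blast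
  then show ?thesis using f(2) by (simp add: card_image)
qed

lemma card_ge_11_6_chi:
  assumes fin: "finite V" and local: "\<And>x. x \<in> V \<Longrightarrow> chi (closed_nbhd V x) + 2 \<le> chi V"
  shows "11 * chi V \<le> 6 * card V"
proof (rule ccontr)
  assume "\<not> ?thesis"
  then have "6 * card V < 11 * chi V" by simp
  then obtain K where K: "K \<subseteq> V" "6 * card K < 11 * chi K" "2 * chi K \<le> card K + 1"
    "\<And>x. x \<in> K \<Longrightarrow> chi (closed_nbhd K x) + chi V \<le> chi (closed_nbhd V x) + chi K"
    using dense_block[OF fin] by metis
  have finK: "finite K" by (rule finite_subset[OF K(1) fin])
  \<comment> \<open>An order of at least \<open>2 * chi K\<close> would contradict the density, and
    \<open>6 * (2 * chi K - 1) < 11 * chi K\<close> gives \<open>chi K \<le> 5\<close>.\<close>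
  have card_K: "card K + 1 = 2 * chi K" and small: "chi K \<le> 5" using K(2,3) by linarith+
  have nbhd: "chi (closed_nbhd K x) + 2 \<le> chi K" if "x \<in> K" for x
    using K(4)[OF that] local[of x] that K(1) by fastforce
  obtain x where x: "x \<in> K" using K(2) by fastforce
  have big: "3 \<le> chi K" using nbhd[OF x] chi_closed_nbhd_pos[OF finK, of x] by linarith
  have triple: "\<exists>u\<in>I. \<exists>v\<in>I. E u v" if I: "I \<subseteq> K" "card I = 3" for I
  proof (rule ccontr)
    assume indep: "\<not> ?thesis"
    have finI: "finite I" by (rule finite_subset[OF I(1) finK])
    \<comment> \<open>\<open>K - I\<close> is locally \<open>(chi K - 2)\<close>-colourable but too small for the bound \<open>5/3\<close>.\<close>
    let ?W = "K - I"
    have "chi I \<le> 1" by (rule chi_independent_le[OF finI]) (use indep in blast)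
    moreover have "chi K \<le> chi (?W \<union> I)" using finK I(1) finI by (intro chi_mono) auto
    moreover have "chi (?W \<union> I) \<le> chi ?W + chi I" using finK finI by (intro chi_Un_le) auto
    ultimately have chi_W: "chi K \<le> chi ?W + 1" by linarith
    have "5 * chi ?W \<le> 3 * card ?W"
    proof (rule card_ge_5_3_chi)
      fix y assume y: "y \<in> ?W"
      have "chi (closed_nbhd ?W y) \<le> chi (closed_nbhd K y)"
        using finK by (intro chi_mono finite_closed_nbhd) (auto simp: closed_nbhd_def)
      then show "chi (closed_nbhd ?W y) < chi ?W" using nbhd[of y] y chi_W by auto
    qed (use finK in simp)
    \<comment> \<open>Now \<open>card ?W = 2 * chi K - 4\<close>, so the bound would read
      \<open>5 * (chi K - 1) \<le> 6 * chi K - 12\<close>, forcing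
      \<open>chi K \<ge> 7\<close>.\<close>
    moreover have "card ?W + 3 = card K"
      using I finI finK card_mono[OF finK I(1)] by (simp add: card_Diff_subset)
    ultimately show False using chi_W card_K small by linarith
  qed
  \<comment> \<open>No independent triples: \<open>S\<close> has classes of size at most 2 and \<open>Q\<close> is a clique, so
    \<open>card K \<le> 1 + 2 * (chi K - 3) + (chi K - 2)\<close>.\<close>
  define S where "S = {u\<in>K. E x u}"
  define Q where "Q = {u\<in>K. \<not> E x u \<and> u \<noteq> x}"
  have finS: "finite S" and finQ: "finite Q" using finK by (simp_all add: S_def Q_def)
  have "K = insert x (S \<union> Q)" using x by (auto simp: S_def Q_def)
  then have "card K \<le> 1 + card (S \<union> Q)"
    using finS finQ by (metis card_insert_le_m1 card_insert_if finite_UnI le_add2 plus_1_eq_Suc order.refl)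
  then have split: "card K \<le> 1 + card S + card Q" using card_Un_le[of S Q] by linarith
  \<comment> \<open>\<open>x\<close> needs a colour of its own beside \<open>S\<close>, which widens
    the gap from two to three.\<close>
  have "chi S + 3 \<le> chi K"
  proof -
    have "chi ({x} \<union> S) = chi {x} + chi S"
      using finS by (intro chi_join) (auto simp: complete_to_def S_def)
    moreover have "chi {x} \<noteq> 0" using chi_eq_0_iff[of "{x}"] by simp
    moreover have "closed_nbhd K x = {x} \<union> S" by (auto simp: closed_nbhd_def S_def)
    ultimately show ?thesis using nbhd[OF x] by simp
  qed
  moreover have "card S \<le> 2 * chi S"
    using triple by (intro card_le_2_chi[OF finS]) (auto simp: S_def)
  moreover have "card Q + 2 \<le> chi K"
  proof (cases "Q = {}")
    case True
    then show ?thesis using big by simp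
  next
    case False
    \<comment> \<open>Two non-adjacent vertices of \<open>Q\<close> would form an independent triple
      with \<open>x\<close>.\<close>
    have clique: "E u v" if uv: "u \<in> Q" "v \<in> Q" "u \<noteq> v" for u v
    proof (rule ccontr)
      assume n: "\<not> E u v"
      have "card {x, u, v} = 3" using uv by (auto simp: Q_def)
      then have "\<exists>a\<in>{x, u, v}. \<exists>b\<in>{x, u, v}. E a b"
        using uv x by (intro triple) (auto simp: Q_def)
      then show False
        using uv n E_irrefl E_sym[of u x] E_sym[of v x] E_sym[of v u] by (auto simp: Q_def)
    qed
    \<comment> \<open>The clique \<open>Q\<close> lies in the closed neighbourhood of each of its
      vertices, where the gap of two applies.\<close>
    obtain u where u: "u \<in> Q" using False by blast
    have "card Q \<le> chi Q" by (rule card_clique_le[OF finQ clique])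
    also have "\<dots> \<le> chi (closed_nbhd K u)"
      using clique u finK by (intro chi_mono finite_closed_nbhd) (auto simp: closed_nbhd_def Q_def)
    finally show ?thesis using nbhd[of u] u by (auto simp: Q_def)
  qed
  \<comment> \<open>\<open>2 * chi K - 1 \<le> 3 * chi K - 7\<close> would force
    \<open>chi K \<ge> 6\<close>.\<close>
  ultimately show False using split card_K small by linarith
qed

section \<open>Subgraphs of large discrepancy\<close>

lemma ex_vertex_seeing_all_colours:
  assumes fin: "finite V" and "V \<noteq> {}" and \<sigma>: "proper_on \<sigma> V" "card (\<sigma> ` V) = chi V"
  shows "\<exists>v\<in>V. \<sigma> ` closed_nbhd V v = \<sigma> ` V"
proof (rule ccontr)
  assume none: "\<not> ?thesis"
  obtain c where c: "c \<in> \<sigma> ` V" using \<open>V \<noteq> {}\<close> by blast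
  have "\<exists>m. m \<in> \<sigma> ` V \<and> m \<notin> \<sigma> ` closed_nbhd V v" if "v \<in> V" for v
  proof -
    have "\<sigma> ` closed_nbhd V v \<subseteq> \<sigma> ` V" using that by (auto simp: closed_nbhd_def)
    then show ?thesis using none that by blast
  qed
  then obtain m where m: "m v \<in> \<sigma> ` V" "m v \<notin> \<sigma> ` closed_nbhd V v" if "v \<in> V" for v
    by metis
  have m_neq: "m u \<noteq> \<sigma> v" if "u \<in> V" "v \<in> V" "E u v \<or> v = u" for u v
    using m(2)[OF that(1)] that by (auto simp: closed_nbhd_def)
  \<comment> \<open>Each vertex of class \<open>c\<close> moves to a colour missing from its closed
    neighbourhood. The class is independent, so the new colouring is proper, and it saves the colour
    \<open>c\<close>.\<close>
  let ?\<tau> = "\<lambda>v. if \<sigma> v = c then m v else \<sigma> v"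
  have "proper_on ?\<tau> V"
    unfolding proper_on_def
  proof (intro ballI impI)
    fix u v assume uv: "u \<in> V" "v \<in> V" "E u v"
    have "\<sigma> u \<noteq> \<sigma> v" using \<sigma>(1) uv unfolding proper_on_def by blast
    then show "?\<tau> u \<noteq> ?\<tau> v" using m_neq[of u v] m_neq[of v u] uv E_sym[OF uv(3)] by auto
  qed
  then have "chi V \<le> card (?\<tau> ` V)" by (rule chi_le[OF fin])
  also have "\<dots> \<le> card (\<sigma> ` V - {c})"
    using fin m(1) m_neq by (intro card_mono) auto
  also have "\<dots> < card (\<sigma> ` V)" using c fin by (intro card_Diff1_less) auto
  finally show False using \<sigma>(2) by simp
qed

theorem ex_discrepant_subset:
  assumes fin: "finite V" and nonempty: "V \<noteq> {}"
    and local: "\<And>v. v \<in> V \<Longrightarrow> chi (closed_nbhd V v) \<le> s"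
    and bound: "6 * chi V < 11 * s + 16"
    and \<sigma>: "proper_on \<sigma> V"
  shows "\<exists>H. H \<subseteq> V \<and> H \<noteq> {} \<and> chi V + chi H \<le> card (\<sigma> ` H) + s"
proof (cases "card (\<sigma> ` V) = chi V")
  case True
  then obtain v where v: "v \<in> V" "\<sigma> ` closed_nbhd V v = \<sigma> ` V"
    using ex_vertex_seeing_all_colours[OF fin nonempty \<sigma>] by blast
  then show ?thesis
    using local[OF v(1)] True by (intro exI[of _ "closed_nbhd V v"]) (auto simp: closed_nbhd_def)
next
  case False
  then have more: "chi V < card (\<sigma> ` V)" using chi_le[OF fin \<sigma>] by simp
  \<comment> \<open>A transversal: one vertex of each colour, so its order is the number of
    colours.\<close>
  obtain R where R: "R \<subseteq> V" "\<sigma> ` R = \<sigma> ` V" "inj_on \<sigma> R"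
    using subset_image_inj[of "\<sigma> ` V" \<sigma> V] by auto
  have finR: "finite R" by (rule finite_subset[OF R(1) fin])
  have card_R: "card R = card (\<sigma> ` V)" using card_image[OF R(3)] R(2) by simp
  have "chi V + chi R \<le> card (\<sigma> ` V) + s"
  proof (rule ccontr)
    assume large: "\<not> ?thesis"
    have "11 * chi R \<le> 6 * card R"
    proof (rule card_ge_11_6_chi[OF finR])
      fix x assume x: "x \<in> R"
      have "chi (closed_nbhd R x) \<le> chi (closed_nbhd V x)"
        using fin R(1) by (intro chi_mono finite_closed_nbhd) (auto simp: closed_nbhd_def)
      also have "\<dots> \<le> s" using x R(1) by (intro local) auto
      finally show "chi (closed_nbhd R x) + 2 \<le> chi R" using large more by linarith
    qed
    then show False using large more bound card_R by linarith
  qed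
  moreover have "R \<noteq> {}" using R(2) nonempty by auto
  ultimately show ?thesis using R(1,2) by auto
qed

end

section \<open>Transfer to graphs as symmetric digraphs\<close>

lemma dominates_induce_subgraph:
  "u \<rightarrow>\<^bsub>G \<restriction> A\<^esub> v \<longleftrightarrow> u \<in> A \<and> v \<in> A \<and> u \<rightarrow>\<^bsub>G\<^esub> v"
  by (auto simp: arcs_ends_conv induce_subgraph_def)

context graph
begin

sublocale adj: adjacency "\<lambda>u v. u \<rightarrow>\<^bsub>G\<^esub> v"
proof
  show "v \<rightarrow>\<^bsub>G\<^esub> u" if "u \<rightarrow>\<^bsub>G\<^esub> v" for u v
    using that sym_arcs by (simp add: symmetric_def symD)
  show "\<not> u \<rightarrow>\<^bsub>G\<^esub> u" for u
    using adj_not_same by blast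
qed

text \<open>Restriction to \<open>A\<close> leaves adjacency inside \<open>A\<close> unchanged, so
  both sides are the same \<open>LEAST\<close> over the same colourings.\<close>

lemma chromatic_number_induce_subgraph: "chromatic_number (G \<restriction> A) = adj.chi A"
proof -
  have "proper_colouring (G \<restriction> A) \<sigma> \<longleftrightarrow> adj.proper_on \<sigma> A" for \<sigma>
    by (auto simp: proper_colouring_def adj.proper_on_def dominates_induce_subgraph)
  then show ?thesis by (simp add: chromatic_number_def adj.chi_def)
qed

lemma proper_colouring_iff: "proper_colouring G \<sigma> \<longleftrightarrow> adj.proper_on \<sigma> (verts G)"
  by (auto simp: proper_colouring_def adj.proper_on_def adj_in_verts)

lemma chromatic_number_eq_chi: "chromatic_number G = adj.chi (verts G)"
  by (simp add: chromatic_number_def adj.chi_def proper_colouring_iff)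

lemma closed_nbhd_verts: "adj.closed_nbhd (verts G) v = closed_neighbourhood G v"
  by (auto simp: adj.closed_nbhd_def closed_neighbourhood_def adj_in_verts)

end

theorem theorem1p5:
  fixes G :: "('a,'b) pre_digraph" and s :: nat
  assumes "s \<ge> 2"
    and "graph G" and "verts G \<noteq> {}"
    and "locally_colourable s G"
    and "real (chromatic_number G) < (11 * real s + 16) / 6"
  shows "chromatic_discrepancy G \<ge> int (chromatic_number G) - int s"
proof -
  interpret graph G by fact
  have "real (6 * adj.chi (verts G)) < real (11 * s + 16)"
    using assms(5) by (simp add: chromatic_number_eq_chi)
  then have bound: "6 * adj.chi (verts G) < 11 * s + 16" by (simp only: of_nat_less_iff)
  have local: "adj.chi (adj.closed_nbhd (verts G) v) \<le> s" if "v \<in> verts G" for v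
    using assms(4) that
    by (simp add: locally_colourable_def closed_nbhd_verts chromatic_number_induce_subgraph)
  have "int (chromatic_number G) - int s \<le> colouring_discrepancy G \<sigma>"
    if \<sigma>: "proper_colouring G \<sigma>" for \<sigma>
  proof -
    obtain H where H: "H \<subseteq> verts G" "H \<noteq> {}"
      "adj.chi (verts G) + adj.chi H \<le> card (\<sigma> ` H) + s"
      using adj.ex_discrepant_subset[OF finite_verts assms(3) local bound]
        \<sigma>[unfolded proper_colouring_iff] by blast
    have "int (card (\<sigma> ` verts (G \<restriction> H))) - int (chromatic_number (G \<restriction> H))
        \<le> colouring_discrepancy G \<sigma>"
      unfolding colouring_discrepancy_def
    proof (rule Max_ge[OF colouring_discrepancy_well_defined(1)[OF assms(2,3)]], rule CollectI)
      show "\<exists>H'. int (card (\<sigma> ` verts (G \<restriction> H))) - int (chromatic_number (G \<restriction> H)) =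
          int (card (\<sigma> ` verts H')) - int (chromatic_number H') \<and>
          induced_subgraph H' G \<and> verts H' \<noteq> {}"
        using induced_induce[OF H(1)] H(2) by (intro exI[of _ "G \<restriction> H"]) simp
    qed
    then show ?thesis
      using H(3) by (simp add: chromatic_number_induce_subgraph chromatic_number_eq_chi)
  qed
  \<comment> \<open>The minimum is attained by some proper colouring, to which the bound just shown
    applies.\<close>
  moreover have "chromatic_discrepancy G \<in> {colouring_discrepancy G \<sigma> | \<sigma>. proper_colouring G \<sigma>}"
    unfolding chromatic_discrepancy_def
    by (rule Min_in[OF chromatic_discrepancy_well_defined[OF assms(2,3)]])
  ultimately show ?thesis by auto
qed

end
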